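(* Let $\mathbb{W}$ be an $m$-dimensional subspace of $\ell_\infty$ and let $\mathcal{A}=\{\widetilde{a_1},\ldots,\widetilde{a_m}\}$ be a basis of $\mathbb{W}$. Suppose that $\mathbb{P}$ is the set of all nonequivalent components of $\mathcal{A}$ satisfying the weak $*$-Property and that $|\mathbb{P}|=r$ (with $r\in\mathbb{N}$). Then $\mathbb{W}$ can be (linearly isometrically) embedded into $\ell_\infty^r$.
   Context: All spaces are over $\mathbb{R}$; $\ell_\infty$ is the space of bounded real sequences with the supremum norm and $\ell_\infty^r$ is $\mathbb{R}^r$ with the maximum norm. Let $\mathcal{A}=\{\widetilde{a_1},\ldots,\widetilde{a_m}\}\subset\ell_\infty$ be linearly independent, $\widetilde{a_k}=(a_1^k,a_2^k,\ldots)$. Put $\mathcal{S}=\{(a_i^1,a_i^2,\ldots,a_i^m)\in\mathbb{R}^m: i\in\mathbb{N}\}$ and let $\overline{\mathcal{S}}$ be its closure in the Euclidean topology of $\mathbb{R}^m$. Elements of $\overline{\mathcal{S}}$ are called components of $\mathcal{A}$. Two components $\mathbf{a},\mathbf{b}\in\overline{\mathcal{S}}$ are equivalent if $\mathbf{a}=\pm\mathbf{b}$, and $E_{\mathbf{a}}=\{\mathbf{b}\in\overline{\mathcal{S}}:\mathbf{b}=\pm\mathbf{a}\}$. A component $\mathbf{a}=(\widehat{a}_1,\ldots,\widehat{a}_m)\in\overline{\mathcal{S}}$ satisfies the weak $*$-Property if there is a nonzero $(\beta_1,\ldots,\beta_m)\in\mathbb{R}^m$ such that $|\sum_{k=1}^m\beta_k\widehat{a}_k|\ge\sup\{|\sum_{k=1}^m\beta_k\widehat{b}_k|:\mathbf{b}=(\widehat{b}_1,\ldots,\widehat{b}_m)\in\overline{\mathcal{S}}\setminus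 E_{\mathbf{a}}\}$ (with $\sup\emptyset=0$). "The set of all nonequivalent components satisfying a property" means a set containing exactly one representative of each equivalence class of components satisfying the property. *)

theory Defs
  imports "HOL-Analysis.Analysis"
begin

text \<open>
  Since \<^typ>\<open>nat\<close> carries the discrete topology, every bounded real sequence is a bounded
  continuous function, and the norm of this type is the supremum norm.
\<close>

type_synonym linf = "nat \<Rightarrow>\<^sub>C real"

definition components :: "('m::finite \<Rightarrow> linf) \<Rightarrow> (real ^ 'm) set" where
  "components a = closure (range (\<lambda>i. \<chi> k. apply_bcontfun (a k) i))"

definition equiv_class :: "('m::finite \<Rightarrow> linf) \<Rightarrow> real ^ 'm \<Rightarrow> (real ^ 'm) set" where
  "equiv_class a x = {y \<in> components a. y = x \<or> y = - x}"

text \<open>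
  The case distinction encodes the convention that the supremum of the empty set is 0.
  The set in the other case is bounded, the members of the family being bounded sequences.
\<close>

definition weak_star_property :: "('m::finite \<Rightarrow> linf) \<Rightarrow> real ^ 'm \<Rightarrow> bool" where
  "weak_star_property a x \<longleftrightarrow>
    (\<exists>\<beta> :: real ^ 'm. \<beta> \<noteq> 0 \<and>
      \<bar>\<Sum>k\<in>UNIV. \<beta> $ k * x $ k\<bar> \<ge>
        (if components a - equiv_class a x = {} then 0
         else SUP y \<in> components a - equiv_class a x. \<bar>\<Sum>k\<in>UNIV. \<beta> $ k * y $ k\<bar>))"

definition all_nonequivalent ::
    "('m::finite \<Rightarrow> linf) \<Rightarrow> (real ^ 'm \<Rightarrow> bool) \<Rightarrow> (real ^ 'm) set \<Rightarrow> bool" where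
  "all_nonequivalent a Q P \<longleftrightarrow>
    P \<subseteq> {x \<in> components a. Q x} \<and>
    (\<forall>x \<in> components a. Q x \<longrightarrow> (\<exists>!p. p \<in> P \<and> p \<in> equiv_class a x))"

text \<open>
  The space of real \<open>r\<close>-tuples with the maximum norm is rendered as \<open>real ^ 'r\<close> equipped with
  \<^const>\<open>infnorm\<close>, because the type-class norm of \<open>real ^ 'r\<close> is the Euclidean one.
  Only the values of the map on the subspace are constrained.
\<close>

definition linear_isometric_embedding :: "linf set \<Rightarrow> (linf \<Rightarrow> real ^ 'r::finite) \<Rightarrow> bool" where
  "linear_isometric_embedding W T \<longleftrightarrow>
    (\<forall>x\<in>W. \<forall>y\<in>W. T (x + y) = T x + T y) \<and>
    (\<forall>c. \<forall>x\<in>W. T (c *\<^sub>R x) = c *\<^sub>R T x) \<and>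
    (\<forall>x\<in>W. infnorm (T x) = norm x)"

end

theory Submission imports Defs begin

text \<open>
  The norm of \<open>w = (\<Sum>k. \<beta> $ k *\<^sub>R a k)\<close> is the supremum of \<open>\<bar>\<beta> \<bullet> x\<bar>\<close> over the rows
  \<open>x\<close> of the family, hence over their closure \<open>components a\<close>.  This closure is compact, so the
  supremum is attained at some component \<open>x\<close>, and a component that maximises \<open>\<bar>\<beta> \<bullet> x\<bar>\<close> for a
  \<open>\<beta> \<noteq> 0\<close> has the weak star property, with \<open>\<beta>\<close> as its witness.  Since \<open>\<bar>\<beta> \<bullet> x\<bar>\<close> does not change when
  \<open>x\<close> is replaced by \<open>- x\<close>, the maximum is also attained on the set \<open>P\<close> of representatives
  (\<open>norm_attained_on_representatives\<close>), whereas no component exceeds it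
  (\<open>inner_component_le_norm\<close>).  Therefore the map that sends \<open>w\<close> to the tuple of the numbers
  \<open>\<beta> \<bullet> p\<close>, \<open>p \<in> P\<close>, where \<open>\<beta>\<close> is the coordinate vector of \<open>w\<close>, is isometric for the maximum norm.
\<close>

lemma apply_bcontfun_sum_scaleR:
  fixes a :: "'m::finite \<Rightarrow> linf" and \<beta> :: "real ^ 'm"
  shows "apply_bcontfun (\<Sum>k\<in>UNIV. \<beta> $ k *\<^sub>R a k) i = \<beta> \<bullet> (\<chi> k. apply_bcontfun (a k) i)"
proof -
  have "apply_bcontfun (\<Sum>k\<in>S. \<beta> $ k *\<^sub>R a k) i = (\<Sum>k\<in>S. \<beta> $ k * apply_bcontfun (a k) i)"
    if "finite S" for S
    using that by induction auto
  then show ?thesis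
    by (simp add: inner_vec_def)
qed

text \<open>
  The bound holds on the rows by definition of the supremum norm; it passes to the closure because
  it is a closed condition on \<open>x\<close>.
\<close>
lemma inner_component_le_norm:
  fixes a :: "'m::finite \<Rightarrow> linf"
  assumes "x \<in> components a"
  shows "\<bar>\<beta> \<bullet> x\<bar> \<le> norm (\<Sum>k\<in>UNIV. \<beta> $ k *\<^sub>R a k)" (is "_ \<le> ?n")
proof -
  have "closed {x. \<bar>\<beta> \<bullet> x\<bar> \<le> ?n}"
    by (intro closed_Collect_le continuous_intros)
  moreover have "range (\<lambda>i. \<chi> k. apply_bcontfun (a k) i) \<subseteq> {x. \<bar>\<beta> \<bullet> x\<bar> \<le> ?n}"
    using norm_bounded[of "\<Sum>k\<in>UNIV. \<beta> $ k *\<^sub>R a k"]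
    by (auto simp: apply_bcontfun_sum_scaleR)
  ultimately show ?thesis
    using assms closure_minimal unfolding components_def by blast
qed

lemma compact_components:
  fixes a :: "'m::finite \<Rightarrow> linf"
  shows "compact (components a)"
proof -
  have "norm (\<chi> k. apply_bcontfun (a k) i) \<le> (\<Sum>k\<in>UNIV. norm (a k))" for i
  proof -
    have "norm (\<chi> k. apply_bcontfun (a k) i) \<le> (\<Sum>k\<in>UNIV. \<bar>apply_bcontfun (a k) i\<bar>)"
      using norm_le_l1_cart[of "\<chi> k. apply_bcontfun (a k) i"] by simp
    also have "\<dots> \<le> (\<Sum>k\<in>UNIV. norm (a k))"
      by (intro sum_mono norm_bounded[where 'b = real, simplified])
    finally show ?thesis .
  qed
  then have "bounded (range (\<lambda>i. \<chi> k. apply_bcontfun (a k) i))"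
    by (auto simp: bounded_iff)
  then show ?thesis
    by (simp add: components_def compact_closure)
qed

text \<open>
  A maximiser exists by compactness, and it dominates every row; the supremum over the rows alone
  need not be attained, which is why the limits of rows are needed.
\<close>
lemma norm_attained_on_components:
  fixes a :: "'m::finite \<Rightarrow> linf"
  obtains x where "x \<in> components a"
    and "\<bar>\<beta> \<bullet> x\<bar> = norm (\<Sum>k\<in>UNIV. \<beta> $ k *\<^sub>R a k)"
proof -
  have row: "(\<chi> k. apply_bcontfun (a k) i) \<in> components a" for i
    unfolding components_def by (rule subsetD[OF closure_subset]) (rule rangeI)
  then have "components a \<noteq> {}"
    by blast
  moreover have "continuous_on (components a) (\<lambda>x. \<bar>\<beta> \<bullet> x\<bar>)"
    by (intro continuous_intros)
  ultimately obtain x where x: "x \<in> components a"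
    and max: "\<And>y. y \<in> components a \<Longrightarrow> \<bar>\<beta> \<bullet> y\<bar> \<le> \<bar>\<beta> \<bullet> x\<bar>"
    using continuous_attains_sup[OF compact_components] by blast
  have "norm (\<Sum>k\<in>UNIV. \<beta> $ k *\<^sub>R a k) \<le> \<bar>\<beta> \<bullet> x\<bar>"
    using max[OF row] by (intro norm_bound) (simp add: apply_bcontfun_sum_scaleR)
  with x inner_component_le_norm[OF x, of \<beta>] that show thesis
    by force
qed

text \<open>
  The supremum in the weak star property ranges over a subset of the components, and \<open>x\<close> is
  maximal among all of them, so the maximised functional itself serves as the witness.
\<close>
lemma maximizer_has_weak_star_property:
  assumes "\<beta> \<noteq> 0" and "\<And>y. y \<in> components a \<Longrightarrow> \<bar>\<beta> \<bullet> y\<bar> \<le> \<bar>\<beta> \<bullet> x\<bar>"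
  shows "weak_star_property a x"
proof -
  have "(SUP y \<in> components a - equiv_class a x. \<bar>\<beta> \<bullet> y\<bar>) \<le> \<bar>\<beta> \<bullet> x\<bar>"
    if "components a - equiv_class a x \<noteq> {}"
    using that assms(2) by (intro cSUP_least) auto
  then have "(if components a - equiv_class a x = {} then 0
      else SUP y \<in> components a - equiv_class a x. \<bar>\<beta> \<bullet> y\<bar>) \<le> \<bar>\<beta> \<bullet> x\<bar>"
    by simp
  with \<open>\<beta> \<noteq> 0\<close> show ?thesis
    unfolding weak_star_property_def by (auto simp only: inner_vec_def inner_real_def)
qed

lemma norm_attained_on_representatives:
  fixes a :: "'m::finite \<Rightarrow> linf"
  assumes "all_nonequivalent a (weak_star_property a) P" and "\<beta> \<noteq> 0"
  obtains p where "p \<in> P" and "\<bar>\<beta> \<bullet> p\<bar> = norm (\<Sum>k\<in>UNIV. \<beta> $ k *\<^sub>R a k)"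
proof -
  obtain x where x: "x \<in> components a"
    and nx: "\<bar>\<beta> \<bullet> x\<bar> = norm (\<Sum>k\<in>UNIV. \<beta> $ k *\<^sub>R a k)"
    by (rule norm_attained_on_components)
  have "weak_star_property a x"
    using maximizer_has_weak_star_property \<open>\<beta> \<noteq> 0\<close> inner_component_le_norm nx by metis
  with x assms(1) obtain p where "p \<in> P" "p \<in> equiv_class a x"
    unfolding all_nonequivalent_def by metis
  with nx that show thesis
    by (auto simp: equiv_class_def)
qed

lemma infnorm_eqI_cart:
  fixes v :: "real ^ 'n"
  assumes "\<And>i. \<bar>v $ i\<bar> \<le> c" and "\<bar>v $ j\<bar> = c"
  shows "infnorm v = c"
proof (rule antisym)
  show "infnorm v \<le> c"
    unfolding infnorm_cart using assms(1) by (intro cSup_least) auto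
  show "c \<le> infnorm v"
    using component_le_infnorm_cart[of v j] assms(2) by simp
qed

theorem theorem2p3:
  fixes W :: "linf set"
    and a :: "'m::finite \<Rightarrow> linf"
    and P :: "(real ^ 'm) set"
  assumes "subspace W"
    and "dim W = CARD('m)"
    and "inj a"
    and "independent (range a)"
    and "span (range a) = W"
    and "all_nonequivalent a (weak_star_property a) P"
    and "finite P"
    and "card P = CARD('r::finite)"
  shows "\<exists>T :: linf \<Rightarrow> real ^ 'r. linear_isometric_embedding W T"
proof -
  obtain f :: "'r \<Rightarrow> real ^ 'm" where f: "bij_betw f UNIV P"
    using finite_same_card_bij[of "UNIV :: 'r set" P] assms(7,8) by auto
  have fP: "f i \<in> components a" for i
    using f assms(6) by (auto simp: bij_betw_def all_nonequivalent_def)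
  define coords :: "linf \<Rightarrow> real ^ 'm" where
    "coords w = (\<chi> k. representation (range a) w (a k))" for w
  define T :: "linf \<Rightarrow> real ^ 'r" where "T w = (\<chi> i. coords w \<bullet> f i)" for w
  have coords_add: "coords (x + y) = coords x + coords y" if "x \<in> W" "y \<in> W" for x y
    using that assms(4,5) by (simp add: coords_def vec_eq_iff representation_add)
  have coords_scale: "coords (c *\<^sub>R x) = c *\<^sub>R coords x" if "x \<in> W" for c x
    using that assms(4,5) by (simp add: coords_def vec_eq_iff representation_scale)
  have expand: "(\<Sum>k\<in>UNIV. coords w $ k *\<^sub>R a k) = w" if "w \<in> W" for w
  proof -
    have "(\<Sum>k\<in>UNIV. coords w $ k *\<^sub>R a k) = (\<Sum>b\<in>range a. representation (range a) w b *\<^sub>R b)"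
      using assms(3) by (simp add: coords_def sum.reindex)
    also have "\<dots> = w"
      using that assms(4,5) by (intro sum_representation_eq) auto
    finally show ?thesis .
  qed
  have "infnorm (T w) = norm w" if w: "w \<in> W" for w
  proof (cases "coords w = 0")
    case True
    \<comment> \<open>The weak star property demands a nonzero \<open>\<beta>\<close>, so this case does not follow from maximality.\<close>
    then have "T w $ i = 0" for i
      by (simp add: T_def)
    then have "T w = 0"
      by (simp add: vec_eq_iff)
    moreover have "w = 0"
      using expand[OF w] True by simp
    ultimately show ?thesis
      by (simp add: infnorm_0)
  next
    case False
    obtain p where "p \<in> P" "\<bar>coords w \<bullet> p\<bar> = norm w"
      using norm_attained_on_representatives[OF assms(6) False] expand[OF w] by metis
    then obtain j where "\<bar>T w $ j\<bar> = norm w"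
      using f by (auto simp: T_def bij_betw_def)
    moreover have "\<bar>T w $ i\<bar> \<le> norm w" for i
      using inner_component_le_norm[OF fP, of "coords w" i] expand[OF w] by (simp add: T_def)
    ultimately show ?thesis
      by (rule infnorm_eqI_cart[rotated])
  qed
  then have "linear_isometric_embedding W T"
    unfolding linear_isometric_embedding_def
    by (simp add: T_def coords_add coords_scale vec_eq_iff inner_add_left)
  then show ?thesis
    by blast
qed

end
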